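(* Let $p\ge 0$, let $\phi:\mathbb{R}^U\times 2^U\to\mathbb{R}^U$ be an update policy which is $\ell_p$-contractive over some invariant subset $\mathcal{I}$, and let $\Delta_0\ge 1$ be an integer. Then, for any fixed choice of the subsets $W_i'\subseteq W_i$ (one for each user), the weighted histogram output by the histogram-building algorithm with update policy $\phi$ has $\ell_p$-sensitivity bounded by $1$. That is, if $D_1,D_2$ are neighboring databases, and the algorithm is run on both with the same hash function and with the same subset $W_i'$ for every user $i$ common to both databases, then the output histograms $H_1,H_2$ satisfy $\|H_1-H_2\|_{\ell_p}\le 1$.
   Context: $U$ is a set (the universe of items, possibly infinite). A database is a finite collection of users with distinct user ids, where user $i$ holds a finite subset $W_i\subseteq U$. Two databases are neighboring if one is obtained from the other by removing a single user. A weighted histogram is a map $H:U\to\mathbb{R}$; $H[u]$ is the weight of $u$. For $p>0$, $\|H\|_{\ell_p}=(\sum_u |H[u]|^p)^{1/p}$ (possibly $+\infty$), and $\|H\|_{\ell_0}$ is the number of $u$ with $H[u]\neq 0$. The $\ell_p$-sensitivity of a map $f$ from databases to histograms is $\sup\|f(D)-f(D')\|_{\ell_p}$ over neighboring $D,D'$. An update policy is a map $\phi:\mathbb{R}^U\times 2^U\to\mathbb{R}^U$ such that $\phi(H,W)-H$ is supported in $W$ for all $H,W$. An update policy $\phi$ is $\ell_p$-contractive (with invariant subset $\mathcal{I}$) if there is a set $\mathcal{I}\subseteq\{(H_1,H_2):\|H_1-H_2\|_{\ell_p}\le 1\}$ of pairs of weighted histograms such that: (1) $(H_1,H_2)\in\mathcal{I}$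 implies $(\phi(H_1,W),\phi(H_2,W))\in\mathcal{I}$ for all $W$; (2) $(\phi(H,W),H)\in\mathcal{I}$ for all $H,W$. Histogram-building algorithm with update policy $\phi$, maximum contribution parameter $\Delta_0$ and an injective hash function from user ids into a totally ordered set: start from the zero histogram $H=0$; order the users by the hash values of their ids; process users in this order. For user $i$, if $|W_i|>\Delta_0$ then $W_i'$ is a randomly chosen subset of $W_i$ of size $\Delta_0$, otherwise $W_i'=W_i$; then replace $H$ by $\phi(H,W_i')$. After all users are processed, output $H$. *)

theory Defs
  imports "HOL-Analysis.Analysis" "HOL-Library.Finite_Map"
begin

text \<open>The universe of items is the type \<open>'u\<close>, user ids are the type \<open>'i\<close>.\<close>

type_synonym 'u histogram = "'u \<Rightarrow> real"

type_synonym ('i, 'u) database = "('i, 'u fset) fmap"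

type_synonym 'u policy = "'u histogram \<Rightarrow> 'u set \<Rightarrow> 'u histogram"

definition removes_user :: "('i, 'u) database \<Rightarrow> ('i, 'u) database \<Rightarrow> bool" where
  "removes_user D D' \<longleftrightarrow> (\<exists>i. i |\<in>| fmdom D \<and> D' = fmdrop i D)"

definition neighboring :: "('i, 'u) database \<Rightarrow> ('i, 'u) database \<Rightarrow> bool" where
  "neighboring D D' \<longleftrightarrow> removes_user D D' \<or> removes_user D' D"

text \<open>
  The case split on summability is needed because \<open>infsum\<close> over the reals is \<open>0\<close> for
  families that are not summable. The definition is only meant for \<open>p \<ge> 0\<close>.
\<close>
definition lp_norm :: "real \<Rightarrow> 'u histogram \<Rightarrow> ennreal" where
  "lp_norm p H =
    (if p = 0 then
       (if finite {u. H u \<noteq> 0} then of_nat (card {u. H u \<noteq> 0}) else \<infinity>)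
     else
       (if (\<lambda>u. \<bar>H u\<bar> powr p) summable_on UNIV
        then ennreal ((\<Sum>\<^sub>\<infinity>u. \<bar>H u\<bar> powr p) powr (1 / p)) else \<infinity>))"

definition lp_dist :: "real \<Rightarrow> 'u histogram \<Rightarrow> 'u histogram \<Rightarrow> ennreal" where
  "lp_dist p H\<^sub>1 H\<^sub>2 = lp_norm p (\<lambda>u. H\<^sub>1 u - H\<^sub>2 u)"

definition lp_sensitivity :: "real \<Rightarrow> (('i, 'u) database \<Rightarrow> 'u histogram) \<Rightarrow> ennreal" where
  "lp_sensitivity p f = (SUP (D, D') \<in> {(D, D'). neighboring D D'}. lp_dist p (f D) (f D'))"

definition update_policy :: "'u policy \<Rightarrow> bool" where
  "update_policy \<phi> \<longleftrightarrow> (\<forall>H W. {u. \<phi> H W u - H u \<noteq> 0} \<subseteq> W)"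

definition lp_contractive ::
    "real \<Rightarrow> 'u policy \<Rightarrow> ('u histogram \<times> 'u histogram) set \<Rightarrow> bool" where
  "lp_contractive p \<phi> \<I> \<longleftrightarrow>
     \<I> \<subseteq> {(H\<^sub>1, H\<^sub>2). lp_dist p H\<^sub>1 H\<^sub>2 \<le> 1} \<and>
     (\<forall>H\<^sub>1 H\<^sub>2 W. (H\<^sub>1, H\<^sub>2) \<in> \<I> \<longrightarrow> (\<phi> H\<^sub>1 W, \<phi> H\<^sub>2 W) \<in> \<I>) \<and>
     (\<forall>H W. (\<phi> H W, H) \<in> \<I>)"

text \<open>
  \<open>c i W\<close> is the outcome of the random choice of a subset of size \<open>\<Delta>\<^sub>0\<close> made for user \<open>i\<close>
  when that user holds \<open>W\<close>; it is irrelevant if \<open>W\<close> has at most \<open>\<Delta>\<^sub>0\<close> elements.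
\<close>
definition valid_choice :: "nat \<Rightarrow> ('i \<Rightarrow> 'u fset \<Rightarrow> 'u fset) \<Rightarrow> bool" where
  "valid_choice \<Delta>\<^sub>0 c \<longleftrightarrow> (\<forall>i W. fcard W > \<Delta>\<^sub>0 \<longrightarrow> c i W |\<subseteq>| W \<and> fcard (c i W) = \<Delta>\<^sub>0)"

text \<open>The set \<open>W\<^sub>i'\<close>; only meaningful for users \<open>i\<close> of the database.\<close>
definition contribution ::
    "nat \<Rightarrow> ('i \<Rightarrow> 'u fset \<Rightarrow> 'u fset) \<Rightarrow> ('i, 'u) database \<Rightarrow> 'i \<Rightarrow> 'u fset" where
  "contribution \<Delta>\<^sub>0 c D i =
     (let W = the (fmlookup D i) in if fcard W > \<Delta>\<^sub>0 then c i W else W)"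

definition build_histogram ::
    "'u policy \<Rightarrow> nat \<Rightarrow> ('i \<Rightarrow> 'h::linorder) \<Rightarrow> ('i \<Rightarrow> 'u fset \<Rightarrow> 'u fset) \<Rightarrow>
     ('i, 'u) database \<Rightarrow> 'u histogram" where
  "build_histogram \<phi> \<Delta>\<^sub>0 hash c D =
     fold (\<lambda>i H. \<phi> H (fset (contribution \<Delta>\<^sub>0 c D i)))
       (sorted_key_list_of_set hash (fset (fmdom D))) (\<lambda>_. 0)"

end

theory Submission
  imports Defs
begin

text \<open>
  The two runs agree until the additional user is reached. That user's update takes the common
  histogram \<open>H\<close> to a pair \<open>(\<phi> H W, H)\<close>, which lies in the invariant subset by condition (2). All
  later users apply the same update to both histograms, so by condition (1) the pair stays there.
\<close>

text \<open>Needed because \<open>\<I>\<close> is not assumed symmetric: condition (2) puts the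
  updated histogram first, so the order of the two databases can only be exchanged at the level of
  distances.\<close>

lemma lp_dist_commute: "lp_dist p H\<^sub>1 H\<^sub>2 = lp_dist p H\<^sub>2 H\<^sub>1"
proof -
  have "H\<^sub>1 u - H\<^sub>2 u \<noteq> 0 \<longleftrightarrow> H\<^sub>2 u - H\<^sub>1 u \<noteq> 0" for u
    by auto
  then show ?thesis
    by (simp add: lp_dist_def lp_norm_def abs_minus_commute)
qed

lemma lp_contractiveD:
  assumes "lp_contractive p \<phi> \<I>"
  shows lp_contractive_dist: "(H\<^sub>1, H\<^sub>2) \<in> \<I> \<Longrightarrow> lp_dist p H\<^sub>1 H\<^sub>2 \<le> 1"
    and lp_contractive_step: "(H\<^sub>1, H\<^sub>2) \<in> \<I> \<Longrightarrow> (\<phi> H\<^sub>1 W, \<phi> H\<^sub>2 W) \<in> \<I>"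
    and lp_contractive_update: "(\<phi> H W, H) \<in> \<I>"
  using assms unfolding lp_contractive_def by auto

lemma lp_contractive_fold:
  assumes "lp_contractive p \<phi> \<I>" "(H\<^sub>1, H\<^sub>2) \<in> \<I>"
  shows "(fold (\<lambda>i H. \<phi> H (W i)) is H\<^sub>1, fold (\<lambda>i H. \<phi> H (W i)) is H\<^sub>2) \<in> \<I>"
  using assms(2)
  by (induction "is" arbitrary: H\<^sub>1 H\<^sub>2) (auto intro: lp_contractive_step[OF assms(1)])

text \<open>An injective key leaves no ties, so the sorted list depends only on the set, and
  dropping \<open>x\<close> does not reorder the rest. Applied to hash values, this gives the two
  runs a common prefix \<open>ys\<close> and a common suffix \<open>zs\<close>.\<close>

lemma (in linorder) sorted_key_list_of_set_split:
  assumes "inj_on f A" "finite A" "x \<in> A"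
  obtains ys zs where "sorted_key_list_of_set f A = ys @ x # zs"
    and "sorted_key_list_of_set f (A - {x}) = ys @ zs"
    and "set ys \<union> set zs = A - {x}"
proof -
  \<comment> \<open>Taking \<open>A\<close> as the ambient set of the locale makes its facts
    available for both \<open>A\<close> and \<open>A - {x}\<close>; injectivity of \<open>f\<close>
    on \<open>A\<close> is the only obligation.\<close>
  interpret folding_insort_key "(\<le>)" "(<)" A f
    by unfold_locales (rule assms(1))
  let ?l = "sorted_key_list_of_set f"
  have set_l: "set (?l A) = A" and dist: "distinct (?l A)"
    using assms(2) distinct_sorted_key_list_of_set[of A] by (auto simp: distinct_map)
  with assms(3) obtain ys zs where l: "?l A = ys @ x # zs"
    using split_list[of x "?l A"] by auto
  have "?l (A - {x}) = remove1 x (?l A)"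
    using assms(2,3) by (intro sorted_key_list_of_set_remove) auto
  \<comment> \<open>By distinctness \<open>x\<close> does not occur in \<open>ys\<close>, so
    \<open>remove1\<close> deletes exactly the displayed occurrence.\<close>
  with l dist set_l that show thesis
    by (auto simp: remove1_append)
qed

text \<open>The conclusion is membership in \<open>\<I>\<close> rather than a distance bound because
  membership is what later updates preserve. The larger database comes first, matching the
  orientation of condition (2).\<close>

lemma build_histogram_remove_user:
  fixes hash :: "'i \<Rightarrow> 'h::linorder"
  assumes contr: "lp_contractive p \<phi> \<I>" and "inj hash" and i: "i |\<in>| fmdom D"
    and eq: "\<And>j. j |\<in>| fmdom D \<Longrightarrow> j \<noteq> i \<Longrightarrow>
      contribution \<Delta>\<^sub>0 c\<^sub>1 D j = contribution \<Delta>\<^sub>0 c\<^sub>2 (fmdrop i D) j"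
  shows "(build_histogram \<phi> \<Delta>\<^sub>0 hash c\<^sub>1 D, build_histogram \<phi> \<Delta>\<^sub>0 hash c\<^sub>2 (fmdrop i D)) \<in> \<I>"
proof -
  let ?W\<^sub>1 = "\<lambda>j. fset (contribution \<Delta>\<^sub>0 c\<^sub>1 D j)"
  let ?W\<^sub>2 = "\<lambda>j. fset (contribution \<Delta>\<^sub>0 c\<^sub>2 (fmdrop i D) j)"
  let ?run = "\<lambda>W. fold (\<lambda>j H. \<phi> H (W j))"
  have "inj_on hash (fset (fmdom D))"
    using \<open>inj hash\<close> by (rule inj_on_subset) simp
  then obtain ys zs
    where l: "sorted_key_list_of_set hash (fset (fmdom D)) = ys @ i # zs"
      and l': "sorted_key_list_of_set hash (fset (fmdom D) - {i}) = ys @ zs"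
      and set_l: "set ys \<union> set zs = fset (fmdom D) - {i}"
    using sorted_key_list_of_set_split[of hash "fset (fmdom D)" i] i by auto
  have dom: "fset (fmdom (fmdrop i D)) = fset (fmdom D) - {i}"
    by auto
  \<comment> \<open>The contributions need not agree at \<open>i\<close>, where the lookup in
    \<open>fmdrop i D\<close> fails; the congruence for \<open>fold\<close> only inspects members of
    \<open>ys\<close> and \<open>zs\<close>, which exclude \<open>i\<close>.\<close>
  have W_eq: "?W\<^sub>1 j = ?W\<^sub>2 j" if "j \<in> set ys \<union> set zs" for j
    using that eq[of j] set_l by auto
  have prefix_eq: "?run ?W\<^sub>2 ys H = ?run ?W\<^sub>1 ys H" and suffix_eq: "?run ?W\<^sub>2 zs H = ?run ?W\<^sub>1 zs H" for H
    using W_eq by (auto intro!: fold_cong)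
  \<comment> \<open>The histogram that both runs have reached just before the turn of
    \<open>i\<close>.\<close>
  let ?H = "?run ?W\<^sub>1 ys (\<lambda>_. 0)"
  have "(?run ?W\<^sub>1 zs (\<phi> ?H (?W\<^sub>1 i)), ?run ?W\<^sub>1 zs ?H) \<in> \<I>"
    by (intro lp_contractive_fold[OF contr] lp_contractive_update[OF contr])
  then show ?thesis
    unfolding build_histogram_def dom l l' by (simp add: prefix_eq suffix_eq)
qed

lemma lp_dist_build_histogram_remove_user:
  fixes hash :: "'i \<Rightarrow> 'h::linorder"
  assumes "lp_contractive p \<phi> \<I>" "inj hash" "removes_user D\<^sub>1 D\<^sub>2"
    and "\<And>i. i |\<in>| fmdom D\<^sub>1 \<Longrightarrow> i |\<in>| fmdom D\<^sub>2 \<Longrightarrow>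
      contribution \<Delta>\<^sub>0 c\<^sub>1 D\<^sub>1 i = contribution \<Delta>\<^sub>0 c\<^sub>2 D\<^sub>2 i"
  shows "lp_dist p (build_histogram \<phi> \<Delta>\<^sub>0 hash c\<^sub>1 D\<^sub>1) (build_histogram \<phi> \<Delta>\<^sub>0 hash c\<^sub>2 D\<^sub>2) \<le> 1"
proof -
  obtain i where i: "i |\<in>| fmdom D\<^sub>1" "D\<^sub>2 = fmdrop i D\<^sub>1"
    using assms(3) unfolding removes_user_def by auto
  show ?thesis
    unfolding i(2)
    by (rule lp_contractive_dist[OF assms(1) build_histogram_remove_user[OF assms(1,2) i(1)]])
      (use assms(4) i(2) in auto)
qed

text \<open>Two choice functions are allowed as long as the resulting subsets agree on common users;
  a single choice function, as in the sensitivity bound, is the case where they coincide.\<close>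

lemma lp_dist_build_histogram_neighboring:
  fixes hash :: "'i \<Rightarrow> 'h::linorder"
  assumes "lp_contractive p \<phi> \<I>" "inj hash" "neighboring D\<^sub>1 D\<^sub>2"
    and eq: "\<And>i. i |\<in>| fmdom D\<^sub>1 \<Longrightarrow> i |\<in>| fmdom D\<^sub>2 \<Longrightarrow>
      contribution \<Delta>\<^sub>0 c\<^sub>1 D\<^sub>1 i = contribution \<Delta>\<^sub>0 c\<^sub>2 D\<^sub>2 i"
  shows "lp_dist p (build_histogram \<phi> \<Delta>\<^sub>0 hash c\<^sub>1 D\<^sub>1) (build_histogram \<phi> \<Delta>\<^sub>0 hash c\<^sub>2 D\<^sub>2) \<le> 1"
  using assms(3) unfolding neighboring_def
proof
  assume "removes_user D\<^sub>1 D\<^sub>2"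
  then show ?thesis
    using eq by (rule lp_dist_build_histogram_remove_user[OF assms(1,2)])
next
  assume "removes_user D\<^sub>2 D\<^sub>1"
  then show ?thesis
    by (subst lp_dist_commute, intro lp_dist_build_histogram_remove_user[OF assms(1,2)])
      (simp_all add: eq)
qed

text \<open>Removing another user leaves the set held by \<open>i\<close> unchanged, and the choice
  depends only on \<open>i\<close> and that set.\<close>

lemma contribution_neighboring:
  assumes "neighboring D\<^sub>1 D\<^sub>2" "i |\<in>| fmdom D\<^sub>1" "i |\<in>| fmdom D\<^sub>2"
  shows "contribution \<Delta>\<^sub>0 c D\<^sub>1 i = contribution \<Delta>\<^sub>0 c D\<^sub>2 i"
  using assms by (auto simp: neighboring_def removes_user_def contribution_def)

theorem theorem1p1:
  fixes p :: real
    and \<phi> :: "'u policy"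
    and \<I> :: "('u histogram \<times> 'u histogram) set"
    and \<Delta>\<^sub>0 :: nat
    and hash :: "'i \<Rightarrow> 'h::linorder"
  assumes "p \<ge> 0"
    and "update_policy \<phi>"
    and "lp_contractive p \<phi> \<I>"
    and "\<Delta>\<^sub>0 \<ge> 1"
    and "inj hash"
  shows "(\<forall>c. valid_choice \<Delta>\<^sub>0 c \<longrightarrow>
            lp_sensitivity p (build_histogram \<phi> \<Delta>\<^sub>0 hash c) \<le> 1) \<and>
         (\<forall>c\<^sub>1 c\<^sub>2 D\<^sub>1 D\<^sub>2.
            valid_choice \<Delta>\<^sub>0 c\<^sub>1 \<longrightarrow> valid_choice \<Delta>\<^sub>0 c\<^sub>2 \<longrightarrow> neighboring D\<^sub>1 D\<^sub>2 \<longrightarrow>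
            (\<forall>i. i |\<in>| fmdom D\<^sub>1 \<and> i |\<in>| fmdom D\<^sub>2 \<longrightarrow>
                 contribution \<Delta>\<^sub>0 c\<^sub>1 D\<^sub>1 i = contribution \<Delta>\<^sub>0 c\<^sub>2 D\<^sub>2 i) \<longrightarrow>
            lp_norm p (\<lambda>u. build_histogram \<phi> \<Delta>\<^sub>0 hash c\<^sub>1 D\<^sub>1 u
                           - build_histogram \<phi> \<Delta>\<^sub>0 hash c\<^sub>2 D\<^sub>2 u) \<le> 1)"
proof (intro conjI allI impI)
  fix c :: "'i \<Rightarrow> 'u fset \<Rightarrow> 'u fset"
  show "lp_sensitivity p (build_histogram \<phi> \<Delta>\<^sub>0 hash c) \<le> 1"
    unfolding lp_sensitivity_def
    by (auto intro!: SUP_least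
        lp_dist_build_histogram_neighboring[OF assms(3,5) _ contribution_neighboring])
next
  fix c\<^sub>1 c\<^sub>2 :: "'i \<Rightarrow> 'u fset \<Rightarrow> 'u fset" and D\<^sub>1 D\<^sub>2 :: "('i, 'u) database"
  assume "neighboring D\<^sub>1 D\<^sub>2"
    and "\<forall>i. i |\<in>| fmdom D\<^sub>1 \<and> i |\<in>| fmdom D\<^sub>2 \<longrightarrow>
      contribution \<Delta>\<^sub>0 c\<^sub>1 D\<^sub>1 i = contribution \<Delta>\<^sub>0 c\<^sub>2 D\<^sub>2 i"
  then show "lp_norm p (\<lambda>u. build_histogram \<phi> \<Delta>\<^sub>0 hash c\<^sub>1 D\<^sub>1 u
      - build_histogram \<phi> \<Delta>\<^sub>0 hash c\<^sub>2 D\<^sub>2 u) \<le> 1"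
    using lp_dist_build_histogram_neighboring[OF assms(3,5)] by (simp add: lp_dist_def)
qed

end
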